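(* Let $L=\prod_{i=1}^m p_i^{r_i}$ be an odd integer, where $p_1<p_2<\dots<p_m$ are distinct primes and each $r_i\ge1$. There exists an equi-difference code $\mathcal{C}\in\mathsf{CAC}(L,3)$ whose leave $\Lambda$ has size $2$ with $\Lambda\ne\{L/3,2L/3\}$ if one of the following holds: (a) $p_1>3$, and every $p_i$ satisfies condition (★) except exactly one index $t$, for which $c_{p_t}=(p_t-1)/2$ and $r_t=1$; (b) $p_1=3$, $r_1=1$, and every $p_i$ with $i\ge2$ satisfies condition (★) except exactly one index $t\ge2$, for which $c_{p_t}=e_{p_t}=(p_t-1)/2$ and $r_t=1$; (c) $p_1=3$, $r_1=2$, and every $p_i$ with $i\ge2$ satisfies condition (★). Here a prime $p$ satisfies condition (★) if $p\equiv5\pmod 8$, or $p\equiv1\pmod8$ and $4\mid e_p$.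
   Context: $\mathcal{P}(L,\omega)$ is the set of $\omega$-element subsets of $\mathbb{Z}_L$. For $\mathcal{I}\in\mathcal{P}(L,\omega)$: $d(\mathcal{I})=\{a-b \bmod L: a,b\in\mathcal{I}\}$, $d^*(\mathcal{I})=d(\mathcal{I})\setminus\{0\}$. A conflict-avoiding code (CAC) of length $L$ and weight $\omega$ is a set $\mathcal{C}\subseteq\mathcal{P}(L,\omega)$ with $d^*(\mathcal{I})\cap d^*(\mathcal{J})=\emptyset$ for all distinct $\mathcal{I},\mathcal{J}\in\mathcal{C}$; $\mathsf{CAC}(L,\omega)$ is the class of these codes. A code is equi-difference if each codeword has the form $\{0,g,2g,\dots,(\omega-1)g\}$ (mod $L$). The leave of $\mathcal{C}$ is $\Lambda=\mathbb{Z}_L\setminus\bigcup_{\mathcal{I}\in\mathcal{C}}d(\mathcal{I})$. For odd $n>2$, $e_n$ is the multiplicative order of $2$ modulo $n$ (least $e\ge1$ with $2^e\equiv1\pmod n$) and $c_n$ is the least $c\ge1$ with $2^c\equiv\pm1\pmod n$ (the multiplicative suborder). *)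

theory Defs
  imports "HOL-Number_Theory.Number_Theory"
begin

(* Elements of Z_L are represented by naturals in {..<L}. *)

definition diffset :: "nat \<Rightarrow> nat set \<Rightarrow> nat set" where
  "diffset L I = {(a + L - b) mod L | a b. a \<in> I \<and> b \<in> I}"

definition diffset_star :: "nat \<Rightarrow> nat set \<Rightarrow> nat set" where
  "diffset_star L I = diffset L I - {0}"

definition Psets :: "nat \<Rightarrow> nat \<Rightarrow> nat set set" where
  "Psets L w = {I. I \<subseteq> {..<L} \<and> card I = w}"

definition is_CAC :: "nat \<Rightarrow> nat \<Rightarrow> nat set set \<Rightarrow> bool" where
  "is_CAC L w C \<longleftrightarrow> C \<subseteq> Psets L w \<and>
     (\<forall>I\<in>C. \<forall>J\<in>C. I \<noteq> J \<longrightarrow> diffset_star L I \<inter> diffset_star L J = {})"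

definition equi_difference :: "nat \<Rightarrow> nat \<Rightarrow> nat set set \<Rightarrow> bool" where
  "equi_difference L w C \<longleftrightarrow> (\<forall>I\<in>C. \<exists>g::nat. I = {(k * g) mod L | k. k < w})"

definition leave :: "nat \<Rightarrow> nat set set \<Rightarrow> nat set" where
  "leave L C = {..<L} - (\<Union>I\<in>C. diffset L I)"

definition e_ord :: "nat \<Rightarrow> nat" where
  "e_ord n = ord n 2"

definition c_subord :: "nat \<Rightarrow> nat" where
  "c_subord n = (LEAST c. c \<ge> 1 \<and> ([2 ^ c = 1] (mod n) \<or> [2 ^ c + 1 = 0] (mod n)))"

definition star_cond :: "nat \<Rightarrow> bool" where
  "star_cond p \<longleftrightarrow> p mod 8 = 5 \<or> (p mod 8 = 1 \<and> 4 dvd e_ord p)"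

end

theory Submission
  imports Defs
begin

text \<open>
  For odd \<open>L\<close> the classes \<open>{x, -x}\<close> of nonzero residues are represented by \<open>1..L div 2\<close>, and
  doubling permutes them. The codeword \<open>{0, g, 2g}\<close> covers exactly the class of \<open>g\<close> and its
  double, so a code amounts to a matching along the cycles of the doubling permutation. Cycles of
  even length are matched perfectly, and the class of \<open>L/3\<close>, a fixed point, is a codeword by itself.
  If \<open>p\<close> satisfies the star condition then \<open>4\<close> divides the order of \<open>2\<close> modulo \<open>p\<close>, hence every
  \<open>n\<close> with \<open>2^n = \<plusminus>1\<close> modulo a multiple of \<open>p\<close> is even: elements whose additive order is divisible
  by such a \<open>p\<close> lie on even cycles. In each of the three cases exactly one further odd cycle
  remains (that of \<open>L/t\<close>, respectively \<open>L/9\<close>), and it leaves a single class unmatched.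
\<close>

section \<open>Matchings along cycles\<close>

lemma funpow_mem:
  assumes "f ` S \<subseteq> S" and "x \<in> S"
  shows "(f ^^ n) x \<in> S"
  using assms by (induction n) auto

lemma inj_on_funpow:
  assumes "inj_on f S" and "f ` S \<subseteq> S"
  shows "inj_on (f ^^ n) S"
proof (induction n)
  case (Suc n)
  have "(f ^^ n) ` S \<subseteq> S" using funpow_mem[OF assms(2)] by blast
  then have "inj_on f ((f ^^ n) ` S)" using assms(1) inj_on_subset by blast
  with Suc show ?case unfolding funpow.simps by (rule comp_inj_on)
qed simp

lemma funpow_cancel:
  assumes "inj_on f S" "f ` S \<subseteq> S" "x \<in> S" "i \<le> j" "(f ^^ i) x = (f ^^ j) x"
  shows "(f ^^ (j - i)) x = x"
proof -
  have "(f ^^ i) ((f ^^ (j - i)) x) = (f ^^ j) x"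
    using assms(4) by (metis add_diff_inverse_nat comp_apply funpow_add linorder_not_less)
  then have "(f ^^ i) ((f ^^ (j - i)) x) = (f ^^ i) x" using assms(5) by simp
  then show ?thesis
    using inj_on_funpow[OF assms(1,2), of i] assms(3) funpow_mem[OF assms(2,3)]
    by (meson inj_onD)
qed

lemma funpow_periodic:
  assumes "finite S" "inj_on f S" "f ` S \<subseteq> S" "x \<in> S"
  shows "\<exists>n>0. (f ^^ n) x = x"
proof -
  have "range (\<lambda>n. (f ^^ n) x) \<subseteq> S" using funpow_mem[OF assms(3,4)] by blast
  then have "finite (range (\<lambda>n. (f ^^ n) x))" using assms(1) finite_subset by blast
  then have "\<not> inj (\<lambda>n. (f ^^ n) x)" using finite_imageD by blast
  then obtain i j where "i < j" "(f ^^ i) x = (f ^^ j) x"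
    unfolding inj_on_def by (metis linorder_neqE_nat)
  then show ?thesis
    using funpow_cancel[OF assms(2,3,4), of i j] by (intro exI[of _ "j - i"]) auto
qed

text \<open>On each cycle fix a start point and let A consist of the points at even distance from
  it. Since every return time is even, the parity of the distance does not depend on the exponent
  chosen, so A and its image alternate around the cycle.\<close>

lemma even_cycles_matching:
  assumes fin: "finite S" and inj: "inj_on f S" and sub: "f ` S \<subseteq> S"
    and ev: "\<And>x n. x \<in> S \<Longrightarrow> (f ^^ n) x = x \<Longrightarrow> even n"
  shows "\<exists>A\<subseteq>S. A \<union> f ` A = S \<and> A \<inter> f ` A = {}"
proof -
  define orb where "orb x = range (\<lambda>n. (f ^^ n) x)" for x
  \<comment> \<open>The choice depends only on the set \<open>orb x\<close>, so all points of one
    cycle get the same start point.\<close>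
  define r where "r x = (SOME y. y \<in> orb x)" for x
  have orb_f: "orb (f x) = orb x" if xS: "x \<in> S" for x
  proof
    show "orb (f x) \<subseteq> orb x"
    proof
      fix y assume "y \<in> orb (f x)"
      then obtain n where "y = (f ^^ n) (f x)" unfolding orb_def by blast
      then have "y = (f ^^ Suc n) x" by (simp only: funpow_Suc_right comp_apply)
      then show "y \<in> orb x" unfolding orb_def by blast
    qed
    obtain m where m: "m > 0" "(f ^^ m) x = x"
      using funpow_periodic[OF fin inj sub xS] by blast
    show "orb x \<subseteq> orb (f x)"
    proof
      fix y assume "y \<in> orb x"
      then obtain n where n: "y = (f ^^ n) x" unfolding orb_def by blast
      \<comment> \<open>One extra turn makes the exponent positive, so that an application of f to x
        can be split off.\<close>
      have "y = (f ^^ (n + m)) x" using n m(2) by (simp add: funpow_add)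
      also have "n + m = Suc (n + m - 1)" using m(1) by simp
      finally have "y = (f ^^ (n + m - 1)) (f x)" by (simp only: funpow_Suc_right comp_apply)
      then show "y \<in> orb (f x)" unfolding orb_def by blast
    qed
  qed
  have orb_n: "orb ((f ^^ n) x) = orb x" if "x \<in> S" for x n
    by (induction n) (use orb_f funpow_mem[OF sub that] in auto)
  have self: "x \<in> orb x" for x
    unfolding orb_def by (metis funpow_0 rangeI)
  have r_in: "r x \<in> orb x" for x
    unfolding r_def using self by (metis someI_ex)
  have rS: "r x \<in> S" if "x \<in> S" for x
    using r_in[of x] funpow_mem[OF sub that] unfolding orb_def by auto
  have r_f: "r (f x) = r x" if "x \<in> S" for x
    unfolding r_def using orb_f[OF that] by simp
  have r_n: "r ((f ^^ n) x) = r x" if "x \<in> S" for x n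
    unfolding r_def using orb_n[OF that] by simp
  have ex: "\<exists>n. x = (f ^^ n) (r x)" if "x \<in> S" for x
  proof -
    obtain n where "r x = (f ^^ n) x" using r_in[of x] unfolding orb_def by blast
    then have "orb (r x) = orb x" using orb_n[OF that] by simp
    then show ?thesis using self[of x] unfolding orb_def by blast
  qed
  have rr: "r (r x) = r x" if "x \<in> S" for x
    using ex[OF that] r_n[OF rS[OF that]] by metis
  define A where "A = {x \<in> S. \<exists>n. even n \<and> x = (f ^^ n) (r x)}"
  have "A \<subseteq> S" unfolding A_def by blast
  moreover have "A \<inter> f ` A = {}"
  proof (rule ccontr)
    assume "A \<inter> f ` A \<noteq> {}"
    then obtain x where x: "x \<in> A" "f x \<in> A" by blast
    then have xS: "x \<in> S" unfolding A_def by blast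
    obtain n where n: "even n" "x = (f ^^ n) (r x)" using x unfolding A_def by blast
    obtain m where m: "even m" "f x = (f ^^ m) (r x)"
      using x r_f[OF xS] unfolding A_def by auto
    \<comment> \<open>The start point reaches \<open>f x\<close> with an odd and with an even
      exponent; cancelling leaves an odd return time.\<close>
    have eq: "(f ^^ Suc n) (r x) = (f ^^ m) (r x)" using n m by simp
    show False
    proof (cases "Suc n \<le> m")
      case True
      then have "even (m - Suc n)"
        using ev[OF rS[OF xS]] funpow_cancel[OF inj sub rS[OF xS] True eq] by blast
      then show False using True n(1) m(1) by auto
    next
      case False
      then have le: "m \<le> Suc n" by simp
      then have "even (Suc n - m)"
        using ev[OF rS[OF xS]] funpow_cancel[OF inj sub rS[OF xS] le eq[symmetric]] by blast
      then show False using le n(1) m(1) by auto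
    qed
  qed
  moreover have "A \<union> f ` A = S"
  proof
    show "A \<union> f ` A \<subseteq> S" using sub unfolding A_def by auto
    show "S \<subseteq> A \<union> f ` A"
    proof
      fix x assume xS: "x \<in> S"
      then obtain n where n: "x = (f ^^ n) (r x)" using ex by blast
      show "x \<in> A \<union> f ` A"
      proof (cases "even n")
        case True
        then show ?thesis using n xS unfolding A_def by blast
      next
        case False
        define y where "y = (f ^^ (n - 1)) (r x)"
        have "y \<in> S" unfolding y_def using funpow_mem[OF sub rS[OF xS]] .
        moreover have "r y = r x" unfolding y_def using r_n[OF rS[OF xS]] rr[OF xS] by simp
        ultimately have "y \<in> A"
          using False unfolding A_def y_def by (auto intro!: exI[of _ "n - 1"])
        moreover have "x = f y"
        proof -
          have "n = Suc (n - 1)" using False by (cases n) auto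
          then have "(f ^^ n) (r x) = f y" unfolding y_def by (metis comp_apply funpow.simps(2))
          with n show ?thesis by simp
        qed
        ultimately show ?thesis by blast
      qed
    qed
  qed
  ultimately show ?thesis by blast
qed

text \<open>Without x, the points f x, ..., f^(c-1) x form a path of even size; pair each odd
  exponent with its successor.\<close>

lemma odd_cycle_matching:
  assumes inj: "inj_on (\<lambda>i. (f ^^ i) x) {..<c}" and "odd c"
  defines "Q \<equiv> (\<lambda>i. (f ^^ i) x) ` {..<c}"
  shows "\<exists>A\<subseteq>Q. A \<union> f ` A = Q - {x} \<and> A \<inter> f ` A = {}"
proof -
  define g where "g i = (f ^^ i) x" for i
  define I where "I = {i. odd i \<and> i < c}"
  have fI: "f ` g ` I = g ` Suc ` I" by (auto simp: g_def image_image)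
  have I1: "I \<subseteq> {..<c}" by (auto simp: I_def)
  \<comment> \<open>As \<open>c\<close> is odd, an odd index below \<open>c\<close> is at most
    \<open>c - 2\<close>, so its successor stays in range.\<close>
  have I2: "Suc ` I \<subseteq> {..<c}"
    using \<open>odd c\<close> by (auto simp: I_def) (metis even_Suc linorder_neqE_nat not_less_eq)
  have U: "I \<union> Suc ` I = {..<c} - {0}"
  proof
    show "I \<union> Suc ` I \<subseteq> {..<c} - {0}" using I2 by (auto simp: I_def)
    show "{..<c} - {0} \<subseteq> I \<union> Suc ` I"
    proof
      fix i assume i: "i \<in> {..<c} - {0}"
      show "i \<in> I \<union> Suc ` I"
      proof (cases "odd i")
        case False
        then have "i = Suc (i - 1)" "i - 1 \<in> I" using i by (auto simp: I_def)
        then show ?thesis by blast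
      qed (use i in \<open>auto simp: I_def\<close>)
    qed
  qed
  have inj': "inj_on g {..<c}" using inj unfolding g_def .
  have "I \<inter> Suc ` I = {}" by (auto simp: I_def)
  then have "g ` I \<inter> f ` g ` I = {}"
    unfolding fI using inj_on_image_Int[OF inj' I1 I2] by simp
  moreover have "g ` I \<union> f ` g ` I = g ` {..<c} - {x}"
  proof -
    have "0 < c" using \<open>odd c\<close> by (cases c) auto
    then have "g ` ({..<c} - {0}) = g ` {..<c} - {g 0}"
      using inj' by (subst inj_on_image_set_diff[OF inj']) auto
    then show ?thesis unfolding fI using U by (simp add: g_def flip: image_Un)
  qed
  moreover have "g ` I \<subseteq> g ` {..<c}" using I1 by blast
  ultimately show ?thesis unfolding Q_def g_def by blast
qed

section \<open>Doubling up to sign\<close>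

definition half_range :: "nat \<Rightarrow> nat set" where
  "half_range L = {x. 0 < x \<and> 2 * x < L}"

text \<open>For odd L this is the representative in \<open>half_range L\<close> of the class of 2x;
  on that range the subtraction does not truncate.\<close>

definition dbl :: "nat \<Rightarrow> nat \<Rightarrow> nat" where
  "dbl L x = min (2 * x) (L - 2 * x)"

lemma finite_half_range [simp]: "finite (half_range L)"
  by (rule finite_subset[of _ "{..<L}"]) (auto simp: half_range_def)

lemma dbl_half_range:
  assumes "odd L"
  shows "dbl L ` half_range L \<subseteq> half_range L"
proof
  fix y assume "y \<in> dbl L ` half_range L"
  then obtain x where "0 < x" "2 * x < L" "y = dbl L x" by (auto simp: half_range_def)
  moreover have "4 * x \<noteq> L" using assms by auto
  ultimately show "y \<in> half_range L" unfolding half_range_def dbl_def by (auto simp: min_def)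
qed

lemma inj_on_dbl:
  assumes "odd L"
  shows "inj_on (dbl L) (half_range L)"
proof (rule inj_onI)
  fix x y assume xy: "x \<in> half_range L" "y \<in> half_range L" "dbl L x = dbl L y"
  \<comment> \<open>If one side were 2x and the other L - 2y, then L = 2(x + y) would be
    even.\<close>
  have "2 * x \<noteq> L - 2 * y" "2 * y \<noteq> L - 2 * x"
    using assms xy by (auto simp: half_range_def) presburger+
  then show "x = y" using xy by (auto simp: half_range_def dbl_def min_def split: if_splits)
qed

lemma dbl_image_half_range:
  assumes "odd L"
  shows "dbl L ` half_range L = half_range L"
  using endo_inj_surj[OF _ dbl_half_range inj_on_dbl] assms by simp

text \<open>Each step replaces y by 2y or by L - 2y; the second flips the sign, which is not
  tracked.\<close>

lemma dbl_power_dvd: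
  assumes "odd L" "x \<in> half_range L"
  shows "int L dvd 2 ^ n * int x - int ((dbl L ^^ n) x) \<or>
         int L dvd 2 ^ n * int x + int ((dbl L ^^ n) x)"
proof (induction n)
  case (Suc n)
  define y where "y = (dbl L ^^ n) x"
  have y: "y \<in> half_range L"
    unfolding y_def using funpow_mem[OF dbl_half_range] assms by blast
  then have "int (dbl L y) = 2 * int y \<or> int (dbl L y) = int L - 2 * int y"
    by (auto simp: dbl_def half_range_def min_def)
  moreover have "int L dvd 2 * (2 ^ n * int x - int y) \<or> int L dvd 2 * (2 ^ n * int x + int y)"
    using Suc unfolding y_def by (meson dvd_mult)
  ultimately consider
      "int (dbl L y) = 2 * int y" "int L dvd 2 * (2 ^ n * int x - int y)"
    | "int (dbl L y) = 2 * int y" "int L dvd 2 * (2 ^ n * int x + int y)"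
    | "int (dbl L y) = int L - 2 * int y" "int L dvd 2 * (2 ^ n * int x - int y)"
    | "int (dbl L y) = int L - 2 * int y" "int L dvd 2 * (2 ^ n * int x + int y)"
    by blast
  then have "int L dvd 2 * 2 ^ n * int x - int (dbl L y) \<or>
             int L dvd 2 * 2 ^ n * int x + int (dbl L y)"
  proof cases
    case 3
    then have "int L dvd 2 * (2 ^ n * int x - int y) + int L" by (intro dvd_add) auto
    also have "\<dots> = 2 * 2 ^ n * int x + int (dbl L y)" using 3 by simp
    finally show ?thesis ..
  next
    case 4
    then have "int L dvd 2 * (2 ^ n * int x + int y) - int L" by (intro dvd_diff) auto
    also have "\<dots> = 2 * 2 ^ n * int x - int (dbl L y)" using 4 by simp
    finally show ?thesis ..
  qed (simp_all add: algebra_simps)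
  then show ?case by (simp add: y_def)
qed simp

text \<open>Here |x - y| < L and 0 < x + y < L, so only x - y = 0 can be a multiple of L.\<close>

lemma half_range_eqI:
  assumes "x \<in> half_range L" "y \<in> half_range L"
    and "int L dvd int x - int y \<or> int L dvd int x + int y"
  shows "x = y"
proof -
  have "\<bar>int x - int y\<bar> < int L" "0 < int x + int y" "int x + int y < int L"
    using assms(1,2) by (auto simp: half_range_def)
  then show ?thesis using assms(3)
    by (metis zdvd_not_zless dvd_abs_iff abs_0_eq abs_ge_zero eq_iff_diff_eq_0 
        linorder_not_less order_le_less of_nat_eq_iff)
qed

text \<open>The n-th iterate represents the class of 2^n x, and a class has only one representative.
  Return times thus become divisibility conditions.\<close>

lemma dbl_power_fixed_iff:
  assumes "odd L" "x \<in> half_range L"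
  shows "(dbl L ^^ n) x = x \<longleftrightarrow> L dvd (2 ^ n - 1) * x \<or> L dvd (2 ^ n + 1) * x"
proof -
  define y where "y = (dbl L ^^ n) x"
  have y: "y \<in> half_range L"
    unfolding y_def using funpow_mem[OF dbl_half_range] assms by blast
  have conv: "L dvd (2 ^ n - 1) * x \<longleftrightarrow> int L dvd 2 ^ n * int x - int x"
    "L dvd (2 ^ n + 1) * x \<longleftrightarrow> int L dvd 2 ^ n * int x + int x"
    by (simp_all flip: int_dvd_int_iff add: of_nat_diff algebra_simps)
  have d: "int L dvd 2 ^ n * int x - int y \<or> int L dvd 2 ^ n * int x + int y"
    unfolding y_def by (rule dbl_power_dvd[OF assms])
  show ?thesis
  proof
    assume "(dbl L ^^ n) x = x"
    then show "L dvd (2 ^ n - 1) * x \<or> L dvd (2 ^ n + 1) * x"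
      using d unfolding conv y_def by simp
  next
    assume "L dvd (2 ^ n - 1) * x \<or> L dvd (2 ^ n + 1) * x"
    then have e: "int L dvd 2 ^ n * int x - int x \<or> int L dvd 2 ^ n * int x + int x"
      unfolding conv .
    have "int L dvd int x - int y \<or> int L dvd int x + int y"
    proof -
      have s: "int L dvd u - v" if "int L dvd u" "int L dvd v" for u v
        using that by (rule dvd_diff)
      from d e show ?thesis
        using s[of "2 ^ n * int x - int y" "2 ^ n * int x - int x"]
          s[of "2 ^ n * int x + int y" "2 ^ n * int x - int x"]
          s[of "2 ^ n * int x + int x" "2 ^ n * int x - int y"]
          s[of "2 ^ n * int x + int x" "2 ^ n * int x + int y"]
        by (auto simp: algebra_simps)
    qed
    then show "(dbl L ^^ n) x = x"
      using half_range_eqI[OF assms(2) y] unfolding y_def by simp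
  qed
qed

section \<open>Codes from matchings\<close>

text \<open>Written exactly as in \<open>equi_difference\<close>, so that a family of such sets is
  equi-difference by unfolding.\<close>

definition codeword :: "nat \<Rightarrow> nat \<Rightarrow> nat set" where
  "codeword L g = {(k * g) mod L | k. k < 3}"

lemma codeword_eq:
  assumes "g \<in> half_range L"
  shows "codeword L g = {0, g, 2 * g}"
proof -
  have "{k::nat. k < 3} = {0, 1, 2}" by auto
  then have "codeword L g = (\<lambda>k. (k * g) mod L) ` {0, 1, 2}"
    unfolding codeword_def setcompr_eq_image by (rule arg_cong)
  then show ?thesis using assms by (simp add: half_range_def)
qed

lemma diffset_image: "diffset L I = (\<lambda>(a, b). (a + L - b) mod L) ` (I \<times> I)"
  by (auto simp: diffset_def)

text \<open>The nonzero differences are +-g and +-2g, and \<open>min z (L - z)\<close> sends a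
  nonzero residue to the representative of its class.\<close>

lemma diffset_codeword:
  assumes "g \<in> half_range L"
  shows "diffset L (codeword L g) = insert 0 {z. 0 < z \<and> z < L \<and> min z (L - z) \<in> {g, dbl L g}}"
proof -
  have g: "0 < g" "2 * g < L" using assms by (auto simp: half_range_def)
  have "diffset L (codeword L g) = (\<lambda>(a, b). (a + L - b) mod L) ` ({0, g, 2 * g} \<times> {0, g, 2 * g})"
    unfolding codeword_eq[OF assms] by (rule diffset_image)
  also have "\<dots> = {0, g, 2 * g, L - g, L - 2 * g}"
  proof -
    have "{0, g, 2 * g} \<times> {0, g, 2 * g} = {(0, 0), (0, g), (0, 2 * g), (g, 0), (g, g), (g, 2 * g),
        (2 * g, 0), (2 * g, g), (2 * g, 2 * g)}" by blast
    moreover have "2 * g + L - g = g + L" "g + L - 2 * g = L - g" using g by simp_all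
    moreover have "(L - g) mod L = L - g" "(L - 2 * g) mod L = L - 2 * g" "g mod L = g"
      "(2 * g) mod L = 2 * g" using g by simp_all
    ultimately show ?thesis by (simp add: insert_commute)
  qed
  also have "\<dots> = insert 0 {z. 0 < z \<and> z < L \<and> min z (L - z) \<in> {g, dbl L g}}"
    using g by (auto simp: dbl_def min_def)
  finally show ?thesis .
qed

text \<open>The codewords of A cover every class except that of x0, and distinct ones share no
  nonzero difference. \<open>disj\<close> admits a fixed point of doubling, that is L/3, whose
  codeword covers a single class. The leave is the class {x0, L - x0}, and
  \<open>3 * x0 \<noteq> L\<close> separates it from {L/3, 2L/3}.\<close>

lemma code_of_matching:
  assumes "odd L" and x0: "x0 \<in> half_range L" "3 * x0 \<noteq> L" and "A \<subseteq> half_range L"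
    and cover: "A \<union> dbl L ` A = half_range L - {x0}"
    and disj: "\<And>g. g \<in> A \<Longrightarrow> dbl L g \<in> A \<Longrightarrow> dbl L g = g"
  shows "\<exists>C. is_CAC L 3 C \<and> equi_difference L 3 C \<and> card (leave L C) = 2 \<and>
           (3 dvd L \<longrightarrow> leave L C \<noteq> {L div 3, 2 * L div 3})"
proof (intro exI conjI)
  let ?C = "codeword L ` A"
  have x: "0 < x0" "2 * x0 < L" using x0 by (auto simp: half_range_def)
  show "equi_difference L 3 ?C"
    unfolding equi_difference_def codeword_def by blast
  show "is_CAC L 3 ?C"
    unfolding is_CAC_def
  proof (intro conjI ballI impI)
    show "?C \<subseteq> Psets L 3"
    proof
      fix I assume "I \<in> ?C"
      then obtain g where g: "g \<in> half_range L" "I = codeword L g" using assms(4) by blast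
      then have "I = {0, g, 2 * g}" "0 < g" "2 * g < L"
        using codeword_eq by (auto simp: half_range_def)
      then show "I \<in> Psets L 3" unfolding Psets_def by auto
    qed
  next
    fix I J assume "I \<in> ?C" "J \<in> ?C" "I \<noteq> J"
    then obtain g k where gk: "g \<in> A" "k \<in> A" "I = codeword L g" "J = codeword L k" "g \<noteq> k"
      by blast
    have H: "g \<in> half_range L" "k \<in> half_range L" using gk assms(4) by auto
    have "dbl L g \<noteq> dbl L k" using inj_on_dbl[OF \<open>odd L\<close>] H gk(5) by (meson inj_onD)
    \<comment> \<open>Either equality would put a double into A; \<open>disj\<close> then makes it a
      fixed point and forces g = k.\<close>
    moreover have "dbl L g \<noteq> k" "dbl L k \<noteq> g" using disj gk by metis+
    ultimately show "diffset_star L I \<inter> diffset_star L J = {}"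
      using gk(5) unfolding diffset_star_def gk(3,4) diffset_codeword[OF H(1)]
        diffset_codeword[OF H(2)] by auto
  qed
  \<comment> \<open>An empty code would leave 0 uncovered as well. It could arise only for L = 3 and
    x0 = 1, where x0 = L/3.\<close>
  have ne: "A \<noteq> {}"
  proof
    assume "A = {}"
    then have H: "half_range L = {x0}" using cover x0 by auto
    have "1 \<in> half_range L" using x by (auto simp: half_range_def)
    then have "x0 = 1" using H by auto
    moreover have "2 \<notin> half_range L" using H \<open>x0 = 1\<close> by auto
    ultimately have "L = 3" using x \<open>odd L\<close> by (auto simp: half_range_def) presburger
    then show False using x0 \<open>x0 = 1\<close> by simp
  qed
  have lv: "leave L ?C = {x0, L - x0}"
  proof -
    have U: "(\<Union>I\<in>?C. diffset L I) =
        insert 0 {z. 0 < z \<and> z < L \<and> min z (L - z) \<in> A \<union> dbl L ` A}"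
    proof -
      have "(\<Union>I\<in>?C. diffset L I) =
          (\<Union>g\<in>A. insert 0 {z. 0 < z \<and> z < L \<and> min z (L - z) \<in> {g, dbl L g}})"
        using diffset_codeword assms(4) by (auto simp: subset_iff)
      also have "\<dots> = insert 0 {z. 0 < z \<and> z < L \<and> min z (L - z) \<in> A \<union> dbl L ` A}"
        using ne by auto
      finally show ?thesis .
    qed
    have "min z (L - z) \<in> half_range L" if "0 < z" "z < L" for z
      using that \<open>odd L\<close> by (auto simp: half_range_def min_def) presburger+
    then have "leave L ?C = {z. 0 < z \<and> z < L \<and> min z (L - z) = x0}"
      unfolding leave_def U cover by auto
    also have "\<dots> = {x0, L - x0}" using x by (auto simp: min_def)
    finally show ?thesis .
  qed
  show "card (leave L ?C) = 2" unfolding lv using x by auto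
  show "3 dvd L \<longrightarrow> leave L ?C \<noteq> {L div 3, 2 * L div 3}"
  proof (intro impI notI)
    assume "3 dvd L" "leave L ?C = {L div 3, 2 * L div 3}"
    then have "x0 = L div 3 \<or> x0 = 2 * L div 3" unfolding lv by auto
    then show False using \<open>3 dvd L\<close> x x0(2) by auto
  qed
qed

text \<open>The half range splits into invariant sets: the odd cycle Q of x0, the set F holding the
  fixed point L/3 (empty if 3 does not divide L), and the rest S, whose cycles are even by
  \<open>ev\<close>. Alternate points match S completely and Q up to x0, while F is its own
  image.\<close>

lemma code_of_single_odd_cycle:
  assumes "odd L" and x0: "x0 \<in> half_range L" "3 * x0 \<noteq> L" and "odd c"
    and period: "(dbl L ^^ c) x0 = x0"
    and minimal: "\<And>n. 0 < n \<Longrightarrow> n < c \<Longrightarrow> (dbl L ^^ n) x0 \<noteq> x0"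
    and ev: "\<And>x n. x \<in> half_range L \<Longrightarrow> 3 * x \<noteq> L \<Longrightarrow> x \<notin> (\<lambda>i. (dbl L ^^ i) x0) ` {..<c}
               \<Longrightarrow> (dbl L ^^ n) x = x \<Longrightarrow> even n"
  shows "\<exists>C. is_CAC L 3 C \<and> equi_difference L 3 C \<and> card (leave L C) = 2 \<and>
           (3 dvd L \<longrightarrow> leave L C \<noteq> {L div 3, 2 * L div 3})"
proof -
  let ?f = "dbl L" and ?H = "half_range L"
  define Q where "Q = (\<lambda>i. (?f ^^ i) x0) ` {..<c}"
  define F where "F = {x \<in> ?H. 3 * x = L}"
  define S where "S = ?H - Q - F"
  note sub = dbl_half_range[OF \<open>odd L\<close>] and inj = inj_on_dbl[OF \<open>odd L\<close>]
  have c0: "0 < c" using \<open>odd c\<close> by (cases c) auto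
  have QH: "Q \<subseteq> ?H" unfolding Q_def using funpow_mem[OF sub x0(1)] by blast
  \<comment> \<open>Cancelling a coincidence of two iterates gives a return before time c.\<close>
  have injQ: "inj_on (\<lambda>i. (?f ^^ i) x0) {..<c}"
  proof (rule linorder_inj_onI)
    fix i j assume "i < j" "i \<in> {..<c}" "j \<in> {..<c}"
    then show "(?f ^^ i) x0 \<noteq> (?f ^^ j) x0"
      using funpow_cancel[OF inj sub x0(1), of i j] minimal[of "j - i"] by auto
  qed auto
  have fF: "?f x = x" if "x \<in> F" for x
    using that by (auto simp: F_def dbl_def min_def)
  have fQ: "?f ` Q = Q"
  proof (rule endo_inj_surj)
    show "?f ` Q \<subseteq> Q"
    proof
      fix y assume "y \<in> ?f ` Q"
      then obtain i where i: "i < c" "y = (?f ^^ Suc i) x0" by (auto simp: Q_def)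
      show "y \<in> Q"
      proof (cases "Suc i = c")
        case True
        then have "y = (?f ^^ 0) x0" using i period by simp
        then show ?thesis using c0 unfolding Q_def by blast
      next
        case False
        then show ?thesis using i unfolding Q_def by (metis Suc_lessI imageI lessThan_iff)
      qed
    qed
    show "inj_on ?f Q" using inj QH inj_on_subset by blast
  qed (simp add: Q_def)
  have fS: "?f ` S \<subseteq> S"
  proof
    fix y assume "y \<in> ?f ` S"
    then obtain x where x: "x \<in> ?H" "x \<notin> Q" "x \<notin> F" "y = ?f x" by (auto simp: S_def)
    have "y \<notin> Q"
    proof
      assume "y \<in> Q"
      then obtain z where "z \<in> Q" "?f x = ?f z" using fQ x(4) by blast
      then have "x = z" using inj x(1) QH by (meson inj_onD subsetD)
      then show False using \<open>z \<in> Q\<close> x(2) by simp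
    qed
    moreover have "y \<notin> F"
    proof
      assume "y \<in> F"
      then have "?f y = ?f x" "y \<in> ?H" using fF x by (auto simp: F_def)
      then have "y = x" using inj x by (meson inj_onD)
      then show False using \<open>y \<in> F\<close> x by simp
    qed
    moreover have "y \<in> ?H" using sub x by blast
    ultimately show "y \<in> S" by (simp add: S_def)
  qed
  have "\<exists>A\<subseteq>S. A \<union> ?f ` A = S \<and> A \<inter> ?f ` A = {}"
  proof (rule even_cycles_matching)
    show "finite S" by (simp add: S_def)
    show "inj_on ?f S" using inj by (rule inj_on_subset) (auto simp: S_def)
    show "?f ` S \<subseteq> S" by (rule fS)
    show "even n" if "x \<in> S" "(?f ^^ n) x = x" for x n
      using ev[of x n] that by (auto simp: S_def F_def Q_def)
  qed
  then obtain A1 where A1: "A1 \<subseteq> S" "A1 \<union> ?f ` A1 = S" "A1 \<inter> ?f ` A1 = {}" by blast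
  have "\<exists>A\<subseteq>Q. A \<union> ?f ` A = Q - {x0} \<and> A \<inter> ?f ` A = {}"
    unfolding Q_def by (rule odd_cycle_matching[OF injQ \<open>odd c\<close>])
  then obtain A2 where A2: "A2 \<subseteq> Q" "A2 \<union> ?f ` A2 = Q - {x0}" "A2 \<inter> ?f ` A2 = {}"
    by blast
  have x0Q: "x0 \<in> Q" using c0 unfolding Q_def by (metis funpow_0 imageI lessThan_iff)
  \<comment> \<open>An orbit that meets a fixed point stays there, so by periodicity x0 itself would
    be L/3.\<close>
  have QF: "Q \<inter> F = {}"
  proof (rule ccontr)
    assume "Q \<inter> F \<noteq> {}"
    then obtain i where i: "i < c" "(?f ^^ i) x0 \<in> F" by (auto simp: Q_def)
    define y where "y = (?f ^^ i) x0"
    have y: "y \<in> F" using i by (simp add: y_def)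
    have "(?f ^^ k) y = y" for k by (induction k) (use fF[OF y] in auto)
    then have "(?f ^^ (c - i)) y = y" .
    moreover have "(?f ^^ (c - i)) y = (?f ^^ c) x0"
      unfolding y_def using i(1)
      by (metis add.commute comp_apply funpow_add le_add_diff_inverse less_imp_le_nat)
    ultimately have "x0 = y" using period by simp
    then show False using y x0 by (simp add: F_def)
  qed
  have fFF: "?f ` F = F" using fF by force
  show ?thesis
  proof (rule code_of_matching[OF \<open>odd L\<close> x0])
    let ?A = "A1 \<union> A2 \<union> F"
    have FH: "F \<subseteq> ?H" by (auto simp: F_def)
    show "?A \<subseteq> ?H" using A1(1) A2(1) QH FH by (auto simp: S_def)
    have "?A \<union> ?f ` ?A = (A1 \<union> ?f ` A1) \<union> (A2 \<union> ?f ` A2) \<union> F"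
      using fFF by (auto simp: image_Un)
    also have "\<dots> = ?H - {x0}"
      unfolding A1(2) A2(2) using QH FH x0Q QF by (auto simp: S_def)
    finally show "?A \<union> ?f ` ?A = ?H - {x0}" .
    fix g assume g: "g \<in> ?A" "?f g \<in> ?A"
    have "A1 \<subseteq> S" "?f ` A1 \<subseteq> S" "A2 \<subseteq> Q" "?f ` A2 \<subseteq> Q" using A1 A2 by auto
    then show "?f g = g" using g fF A1(3) A2(3) QF by (auto simp: S_def)
  qed
qed

section \<open>The star condition\<close>

text \<open>Gauss's lemma for 2, read off from the product of all values of \<^const>\<open>dbl\<close>.\<close>

lemma two_power_half_5_mod_8:
  assumes "prime p" "p mod 8 = 5"
  shows "[2 ^ ((p - 1) div 2) = - 1] (mod int p)"
proof -
  define m where "m = p div 8"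
  have p: "p = 8 * m + 5" using assms(2) unfolding m_def by presburger
  have "odd p" using p by simp
  let ?H = "half_range p"
  have H: "?H = {1..4 * m + 2}" unfolding half_range_def p by auto
  \<comment> \<open>Below p/4 the double stays in the half range; above p/4 it is reflected, which
    contributes the sign -1.\<close>
  have cong: "[int (dbl p x) = (if x \<le> 2 * m + 1 then 1 else - 1) * (2 * int x)] (mod int p)"
    if "x \<in> ?H" for x
  proof (cases "x \<le> 2 * m + 1")
    case True
    then have "dbl p x = 2 * x" unfolding dbl_def p by simp
    then show ?thesis using True by simp
  next
    case False
    then have "dbl p x = p - 2 * x" unfolding dbl_def p by simp
    then have "int (dbl p x) = int p - 2 * int x" using that H p by auto
    then show ?thesis using False by (simp add: cong_iff_dvd_diff)
  qed
  \<comment> \<open>The reflected elements are 2m + 2, ..., 4m + 2: there are 2m + 1 of them, an odd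
    number.\<close>
  have sgn: "(\<Prod>x\<in>?H. (if x \<le> 2 * m + 1 then 1 else - 1) :: int) = - 1"
  proof -
    have "?H = {1..2 * m + 1} \<union> {2 * m + 2..4 * m + 2}" unfolding H by auto
    then have "(\<Prod>x\<in>?H. (if x \<le> 2 * m + 1 then 1 else - 1) :: int) =
      (\<Prod>x\<in>{1..2 * m + 1}. (if x \<le> 2 * m + 1 then 1 else - 1)) *
      (\<Prod>x\<in>{2 * m + 2..4 * m + 2}. (if x \<le> 2 * m + 1 then 1 else - 1))"
      by (simp only:) (rule prod.union_disjoint, auto)
    also have "(\<Prod>x\<in>{1..2 * m + 1}. (if x \<le> 2 * m + 1 then 1 else - 1) :: int) = 1"
      by (rule prod.neutral) auto
    also have "(\<Prod>x\<in>{2 * m + 2..4 * m + 2}. (if x \<le> 2 * m + 1 then 1 else - 1) :: int)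
        = (\<Prod>x\<in>{2 * m + 2..4 * m + 2}. - 1)"
      by (rule prod.cong) auto
    finally show ?thesis by simp
  qed
  \<comment> \<open>Doubling permutes the half range, so the product of the doubles is the original
    product, which is coprime to p and can be cancelled.\<close>
  have "(\<Prod>x\<in>?H. int x) = (\<Prod>x\<in>?H. int (dbl p x))"
    using prod.reindex[OF inj_on_dbl[OF \<open>odd p\<close>], of int] dbl_image_half_range[OF \<open>odd p\<close>]
    by (simp add: comp_def)
  moreover have "[(\<Prod>x\<in>?H. int (dbl p x)) =
      (\<Prod>x\<in>?H. (if x \<le> 2 * m + 1 then 1 else - 1) * (2 * int x))] (mod int p)"
    by (rule cong_prod) (use cong in blast)
  moreover have "(\<Prod>x\<in>?H. (if x \<le> 2 * m + 1 then 1 else - 1) * (2 * int x))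
      = - (2 ^ (4 * m + 2)) * (\<Prod>x\<in>?H. int x)"
  proof -
    have "card ?H = 4 * m + 2" unfolding H by simp
    then show ?thesis by (simp only: prod.distrib sgn prod_constant)
  qed
  ultimately have "[1 * (\<Prod>x\<in>?H. int x) = - (2 ^ (4 * m + 2)) * (\<Prod>x\<in>?H. int x)] (mod int p)"
    by simp
  moreover have "coprime (\<Prod>x\<in>?H. int x) (int p)"
  proof (rule prod_coprime_left)
    fix x assume "x \<in> ?H"
    then have "0 < x" "x < p" by (auto simp: half_range_def)
    then have "\<not> p dvd x" by (auto dest: dvd_imp_le)
    then show "coprime (int x) (int p)"
      using assms(1) prime_imp_coprime coprime_commute by (metis coprime_int_iff)
  qed
  ultimately have "[1 = - (2 ^ (4 * m + 2))] (mod int p)"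
    using cong_mult_rcancel by blast
  then have "[2 ^ (4 * m + 2) = - 1] (mod int p)"
    by (metis cong_minus_minus_iff cong_sym minus_minus)
  moreover have "(p - 1) div 2 = 4 * m + 2" using p by simp
  ultimately show ?thesis by simp
qed

text \<open>For p = 5 modulo 8 the order divides p - 1 = 4(2m + 1) but not (p - 1) / 2, because
  2^((p - 1) / 2) = -1; hence it contains the full factor 4. For p = 1 modulo 8 the claim is part of
  the star condition.\<close>

lemma star_cond_four_dvd_ord:
  assumes "prime p" "star_cond p"
  shows "4 dvd ord p 2"
proof (cases "p mod 8 = 5")
  case True
  define m where "m = p div 8"
  have p: "p = 8 * m + 5" using True unfolding m_def by presburger
  let ?e = "ord p 2"
  have "coprime 2 p" using p by simp
  then have "[2 ^ (p - 1) = 1] (mod p)"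
    using fermat_theorem[OF assms(1), of 2] assms(1) p
    by (metis coprime_absorb_right dvd_refl not_prime_unit prime_imp_coprime coprime_commute)
  then have "?e dvd p - 1" using ord_divides by blast
  then obtain k where k: "4 * (2 * m + 1) = ?e * k" using p by (auto elim!: dvdE)
  have "odd k"
  proof
    assume "even k"
    then obtain l where "k = 2 * l" by blast
    then have "4 * m + 2 = ?e * l" using k by simp
    then have "?e dvd (p - 1) div 2" using p by simp
    then have "[2 ^ ((p - 1) div 2) = 1] (mod p)" using ord_divides by blast
    then have "[2 ^ ((p - 1) div 2) = 1] (mod int p)"
      by (metis cong_int_iff of_nat_1 of_nat_numeral of_nat_power)
    then have "[1 = - 1] (mod int p)"
      using two_power_half_5_mod_8[OF assms(1) True] cong_sym cong_trans by blast
    then have "int p dvd 2" by (simp add: cong_iff_dvd_diff)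
    then show False using p by (auto dest: zdvd_imp_le)
  qed
  then have "coprime (2 ^ 2) k" by (subst coprime_power_left_iff) simp
  then have "coprime 4 k" by simp
  moreover have "4 dvd ?e * k" using k by (metis dvd_triv_left)
  ultimately show ?thesis by (simp add: coprime_dvd_mult_left_iff)
next
  case False
  then show ?thesis using assms(2) by (simp add: star_cond_def e_ord_def)
qed

text \<open>Both numbers divide 2^(2n) - 1 = (2^n - 1)(2^n + 1).\<close>

lemma ord_dvd_of_two_power_pm1:
  fixes p :: nat
  assumes "p dvd 2 ^ n - 1 \<or> p dvd 2 ^ n + 1"
  shows "ord p 2 dvd 2 * n"
proof -
  obtain a :: nat where a: "2 ^ n = Suc a" by (metis not0_implies_Suc power_not_zero zero_neq_numeral)
  have "(2::nat) ^ (2 * n) = 2 ^ n * 2 ^ n" by (simp add: mult_2 power_add)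
  then have "(2 ^ n - 1) * (2 ^ n + 1) = (2 ^ (2 * n) - 1 :: nat)" by (simp add: a)
  then have "p dvd 2 ^ (2 * n) - 1"
    using assms by (metis dvd_mult dvd_mult2)
  then have "[2 ^ (2 * n) = 1] (mod p)"
    by (metis cong_altdef_nat cong_sym one_le_numeral one_le_power)
  then show ?thesis using ord_divides by blast
qed

text \<open>The additive order q of x modulo L divides MN but not M, so it shares a prime p with N.
  This p divides 2^n - 1 or 2^n + 1, hence 4 divides \<open>ord p 2\<close>, which divides
  2n.\<close>

lemma star_cycle_even:
  assumes "L = M * N" "0 < L" and star: "\<And>p. prime p \<Longrightarrow> p dvd N \<Longrightarrow> star_cond p"
    and x: "\<not> L dvd M * x" and d: "L dvd (2 ^ n - 1) * x \<or> L dvd (2 ^ n + 1) * x"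
  shows "even n"
proof -
  define q where "q = L div gcd L x"
  have cancel: "L dvd k * x \<longleftrightarrow> q dvd k" for k
  proof -
    define g where "g = gcd L x"
    have g: "g > 0" "L = q * g" using assms(2) by (auto simp: q_def g_def)
    obtain y where y: "x = y * g" unfolding g_def by (metis dvdE gcd_dvd2 mult.commute)
    have "coprime q y" 
    proof -
      have "gcd (q * g) (y * g) = g" using g(2) y unfolding g_def by metis
      then have "gcd q y * g = g" by (simp add: gcd_mult_distrib_nat mult.commute)
      then have "gcd q y = 1" using g(1) by simp
      then show ?thesis by (simp only: coprime_iff_gcd_eq_1)
    qed
    have "L dvd k * x \<longleftrightarrow> q * g dvd (k * y) * g" using g(2) y by (simp add: mult.assoc)
    also have "\<dots> \<longleftrightarrow> q dvd k * y" using g(1) by simp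
    also have "\<dots> \<longleftrightarrow> q dvd k" using \<open>coprime q y\<close> by (simp add: coprime_dvd_mult_left_iff)
    finally show ?thesis .
  qed
  have "q dvd M * N" using cancel[of L] assms(1) by simp
  moreover have "\<not> q dvd M" using cancel x by blast
  ultimately have "\<not> coprime q N" by (auto simp: coprime_dvd_mult_left_iff)
  then obtain r where r: "r dvd q" "r dvd N" "r \<noteq> 1" by (metis not_coprimeE is_unit_gcd nat_dvd_1_iff_1)
  then obtain p where "prime p" "p dvd r" using prime_factor_nat by blast
  with r have p: "prime p" "p dvd q" "p dvd N" by (blast intro: dvd_trans)+
  have "p dvd 2 ^ n - 1 \<or> p dvd 2 ^ n + 1" using d p(2) unfolding cancel by (meson dvd_trans)
  then have "4 dvd 2 * n"
    using ord_dvd_of_two_power_pm1 star_cond_four_dvd_ord[OF p(1) star[OF p(1,3)]] dvd_trans by blast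
  then show ?thesis by presburger
qed

section \<open>The remaining odd cycle\<close>

definition two_power_pm1 :: "nat \<Rightarrow> nat \<Rightarrow> bool" where
  "two_power_pm1 t n \<longleftrightarrow> t dvd 2 ^ n - 1 \<or> t dvd 2 ^ n + 1"

lemma c_subord_alt: "c_subord t = (LEAST c. c \<ge> 1 \<and> two_power_pm1 t c)"
proof -
  have "[2 ^ c = 1] (mod t) \<longleftrightarrow> t dvd 2 ^ c - 1" for c
    by (metis cong_altdef_nat one_le_numeral one_le_power)
  moreover have "[2 ^ c + 1 = 0] (mod t) \<longleftrightarrow> t dvd 2 ^ c + 1" for c
    by (rule cong_0_iff)
  ultimately show ?thesis unfolding c_subord_def two_power_pm1_def by simp
qed

lemma two_power_pm1_ord:
  assumes "odd t"
  shows "two_power_pm1 t (ord t 2)" and "0 < ord t 2"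
proof -
  have "[2 ^ ord t 2 = 1] (mod t)" by (rule ord)
  then show "two_power_pm1 t (ord t 2)"
    unfolding two_power_pm1_def by (metis cong_altdef_nat one_le_numeral one_le_power)
  show "0 < ord t 2" using assms by (simp add: ord_eq_0 flip: neq0_conv)
qed

text \<open>The order of 2 is an admissible exponent, so the \<open>LEAST\<close> is
  attained.\<close>

lemma c_subord_props:
  assumes "odd t"
  shows "0 < c_subord t" "two_power_pm1 t (c_subord t)"
    and "\<And>n. 0 < n \<Longrightarrow> n < c_subord t \<Longrightarrow> \<not> two_power_pm1 t n"
proof -
  have "1 \<le> ord t 2" using two_power_pm1_ord(2)[OF assms] by linarith
  then have "1 \<le> c_subord t \<and> two_power_pm1 t (c_subord t)"
    unfolding c_subord_alt using two_power_pm1_ord(1)[OF assms]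
    by (intro LeastI[of "\<lambda>c. c \<ge> 1 \<and> two_power_pm1 t c" "ord t 2"]) blast
  then show "0 < c_subord t" "two_power_pm1 t (c_subord t)" by auto
  show "\<not> two_power_pm1 t n" if "0 < n" "n < c_subord t" for n
    using not_less_Least[of n "\<lambda>c. c \<ge> 1 \<and> two_power_pm1 t c"] that unfolding c_subord_alt by auto
qed

text \<open>
  If the cycle were even then \<open>t = 1\<close> modulo \<open>8\<close>, so \<open>4\<close> would divide the suborder and hence the
  order, and \<open>t\<close> would satisfy the star condition.
\<close>

lemma odd_c_subord:
  assumes "prime t" "odd t" "\<not> star_cond t" "c_subord t = (t - 1) div 2"
  shows "odd ((t - 1) div 2)"
proof
  assume ev: "even ((t - 1) div 2)"
  define e where "e = ord t 2"
  have "coprime 2 t" using assms(2) by simp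
  then have "[2 ^ (t - 1) = 1] (mod t)"
    using fermat_theorem[OF assms(1), of 2] assms(1)
    by (metis coprime_absorb_right dvd_refl not_prime_unit prime_imp_coprime coprime_commute)
  then have "e dvd t - 1" unfolding e_def using ord_divides by blast
  have le: "(t - 1) div 2 \<le> e"
    using c_subord_props(3)[OF assms(2), of e] two_power_pm1_ord[OF assms(2)] assms(4)
    unfolding e_def by (metis linorder_not_less)
  obtain k where k: "t - 1 = e * k" using \<open>e dvd t - 1\<close> by blast
  have "t > 1" using assms(1) prime_gt_1_nat by blast
  \<comment> \<open>An even (t - 1) / 2 means t = 1 or 5 modulo 8, and 5 would give the star
    condition.\<close>
  have "t mod 8 = 1"
  proof -
    have "t mod 8 \<noteq> 5" using assms(3) by (simp add: star_cond_def)
    then show ?thesis using ev assms(2) by presburger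
  qed
  then have "8 dvd t - 1" using \<open>t > 1\<close> by presburger
  have "k \<noteq> 0" using k \<open>t > 1\<close> by (intro notI) simp
  have "e > 0" using two_power_pm1_ord(2)[OF assms(2)] by (simp add: e_def)
  \<comment> \<open>The order \<open>e\<close> is at least the suborder (t - 1) / 2, so t - 1 is e
    or 2e.\<close>
  have "k \<le> 2"
  proof (rule ccontr)
    assume "\<not> k \<le> 2"
    then have "3 * e \<le> t - 1" using k by (simp add: mult.commute)
    moreover obtain s where "t = 2 * s + 1" using assms(2) oddE by blast
    ultimately show False using le \<open>e > 0\<close> by simp
  qed
  then have "k = 1 \<or> k = 2" using \<open>k \<noteq> 0\<close> by auto
  then have "4 dvd e" using k \<open>8 dvd t - 1\<close> by auto
  then show False using \<open>t mod 8 = 1\<close> assms(3) by (simp add: star_cond_def e_ord_def e_def)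
qed

text \<open>With N = L/t, the classes annihilated by t are those of jN for 1 <= j <= (t - 1) / 2.
  The cycle of N stays among them and has \<open>c_subord t\<close> = (t - 1) / 2 points, so it
  exhausts them. All other elements except L/3 are left to \<open>ev\<close>.\<close>

lemma code_of_prime_cycle:
  assumes "odd L" "L = t * N" "prime t" "t \<noteq> 3" "\<not> star_cond t" "c_subord t = (t - 1) div 2"
    and ev: "\<And>x n. x \<in> half_range L \<Longrightarrow> 3 * x \<noteq> L \<Longrightarrow> \<not> L dvd t * x
               \<Longrightarrow> L dvd (2 ^ n - 1) * x \<or> L dvd (2 ^ n + 1) * x \<Longrightarrow> even n"
  shows "\<exists>C. is_CAC L 3 C \<and> equi_difference L 3 C \<and> card (leave L C) = 2 \<and>
           (3 dvd L \<longrightarrow> leave L C \<noteq> {L div 3, 2 * L div 3})"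
proof -
  define c where "c = (t - 1) div 2"
  have t: "odd t" "N > 0" using assms(1,2) by (auto intro: Nat.gr0I)
  have "t > 1" using assms(3) prime_gt_1_nat by blast
  have "t > 3" using \<open>t > 1\<close> t \<open>t \<noteq> 3\<close> by presburger
  note sub = dbl_half_range[OF \<open>odd L\<close>] and inj = inj_on_dbl[OF \<open>odd L\<close>]
  have "2 * N < t * N" using \<open>t > 3\<close> t(2) by simp
  then have NH: "N \<in> half_range L" using t(2) assms(2) by (simp add: half_range_def)
  have "L dvd k * N \<longleftrightarrow> t dvd k" for k using t(2) assms(2) by simp
  then have fixN: "(dbl L ^^ n) N = N \<longleftrightarrow> two_power_pm1 t n" for n
    unfolding dbl_power_fixed_iff[OF \<open>odd L\<close> NH] two_power_pm1_def by presburger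
  have minimal: "(dbl L ^^ n) N \<noteq> N" if "0 < n" "n < c" for n
    using c_subord_props(3)[OF t(1), of n] that fixN assms(6) by (simp add: c_def)
  define Q where "Q = (\<lambda>i. (dbl L ^^ i) N) ` {..<c}"
  define R where "R = {x \<in> half_range L. L dvd t * x}"
  have RN: "R = (\<lambda>j. j * N) ` {1..c}"
  proof
    show "R \<subseteq> (\<lambda>j. j * N) ` {1..c}"
    proof
      fix x assume x: "x \<in> R"
      then have "N dvd x" using \<open>t > 1\<close> by (auto simp: R_def assms(2))
      then obtain j where j: "x = j * N" by (metis dvdE mult.commute)
      have "0 < j * N" "(2 * j) * N < t * N" using x j assms(2) by (auto simp: R_def half_range_def)
      then have "0 < j" "2 * j < t" by auto
      then have "j \<in> {1..c}" unfolding c_def using t(1) by auto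
      then show "x \<in> (\<lambda>j. j * N) ` {1..c}" using j by blast
    qed
    show "(\<lambda>j. j * N) ` {1..c} \<subseteq> R"
    proof
      fix x assume "x \<in> (\<lambda>j. j * N) ` {1..c}"
      then obtain j where "x = j * N" "j \<in> {1..c}" by blast
      then have j: "x = j * N" "1 \<le> j" "j \<le> c" by simp_all
      then have "2 * j < t" unfolding c_def using t(1) \<open>t > 1\<close> by presburger
      then have "(2 * j) * N < t * N" using t(2) by simp
      then show "x \<in> R" using j t(2) by (simp add: R_def half_range_def assms(2))
    qed
  qed
  have "inj_on (\<lambda>j. j * N) {1..c}" using t(2) by (auto simp: inj_on_def)
  then have cardR: "card R = c" "finite R" unfolding RN by (simp_all add: card_image)
  have injQ: "inj_on (\<lambda>i. (dbl L ^^ i) N) {..<c}"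
  proof (rule linorder_inj_onI)
    fix i j assume "i < j" "i \<in> {..<c}" "j \<in> {..<c}"
    then show "(dbl L ^^ i) N \<noteq> (dbl L ^^ j) N"
      using funpow_cancel[OF inj sub NH, of i j] minimal[of "j - i"] by auto
  qed auto
  \<comment> \<open>Doubling up to sign modulo L preserves divisibility by N, since N divides
    L.\<close>
  have QR: "Q \<subseteq> R"
  proof
    fix y assume "y \<in> Q"
    then obtain i where i: "y = (dbl L ^^ i) N" by (auto simp: Q_def)
    have "int L dvd 2 ^ i * int N - int y \<or> int L dvd 2 ^ i * int N + int y"
      unfolding i by (rule dbl_power_dvd[OF \<open>odd L\<close> NH])
    moreover have "int N dvd int L" using assms(2) by simp
    ultimately have "int N dvd 2 ^ i * int N - int y \<or> int N dvd 2 ^ i * int N + int y"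
      using dvd_trans by blast
    then have "int N dvd int y"
      by (metis dvd_add_right_iff dvd_diff_right_iff dvd_triv_right)
    then have "L dvd t * y" using assms(2) by simp
    moreover have "y \<in> half_range L" unfolding i using funpow_mem[OF sub NH] .
    ultimately show "y \<in> R" by (simp add: R_def)
  qed
  have "card Q = c" unfolding Q_def using card_image[OF injQ] by simp
  then have "Q = R" using card_subset_eq[OF cardR(2) QR] cardR(1) by simp
  show ?thesis
  proof (rule code_of_single_odd_cycle[OF \<open>odd L\<close> NH])
    show "3 * N \<noteq> L" using assms(2,4) t(2) by simp
    show "odd c" unfolding c_def using odd_c_subord assms t(1) by blast
    show "(dbl L ^^ c) N = N"
      using c_subord_props(2)[OF t(1)] fixN assms(6) by (simp add: c_def)
    show "(dbl L ^^ n) N \<noteq> N" if "0 < n" "n < c" for n using minimal that .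
    show "even n" if "x \<in> half_range L" "3 * x \<noteq> L" "x \<notin> (\<lambda>i. (dbl L ^^ i) N) ` {..<c}"
      "(dbl L ^^ n) x = x" for x n
    proof (rule ev[OF that(1,2)])
      show "\<not> L dvd t * x" using that(1,3) \<open>Q = R\<close> unfolding Q_def R_def by blast
      show "L dvd (2 ^ n - 1) * x \<or> L dvd (2 ^ n + 1) * x"
        using that(4) dbl_power_fixed_iff[OF \<open>odd L\<close> that(1)] by simp
    qed
  qed
qed

section \<open>Exponents modulo 3t, and prime factors of cofactors\<close>

lemma two_power_odd_mod_3:
  assumes "odd n"
  shows "[2 ^ n = 2] (mod (3::nat))"
proof -
  obtain k where "n = 2 * k + 1" using assms by (metis oddE)
  then have "(2::nat) ^ n = 4 ^ k * 2" by (simp add: power_mult)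
  moreover have "[4 ^ k * 2 = 1 ^ k * 2] (mod (3::nat))"
    by (intro cong_mult cong_pow) (auto simp: cong_def)
  ultimately show ?thesis by simp
qed

text \<open>For odd n, 2^n = -1 modulo 3, so the common sign is minus and 2^n = -1 modulo t too. But
  the odd order of 2 divides 2n, hence n, so 2^n = 1 modulo t, and t would divide 2.\<close>

lemma two_power_pm1_3t_even:
  fixes t :: nat
  assumes "odd t" "t > 1" "odd (ord t 2)"
    and "3 dvd (2 ^ n - 1 :: nat) \<and> t dvd 2 ^ n - 1 \<or> 3 dvd (2 ^ n + 1 :: nat) \<and> t dvd 2 ^ n + 1"
  shows "even n"
proof (rule ccontr)
  assume "\<not> even n"
  then have m: "(2::nat) ^ n mod 3 = 2" using two_power_odd_mod_3[of n] by (simp add: cong_def)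
  have "\<not> (3::nat) dvd 2 ^ n - 1"
  proof -
    have "(2::nat) ^ n \<ge> 1" by simp
    then show ?thesis using m by presburger
  qed
  then have t: "t dvd 2 ^ n + 1" using assms(4) by blast
  then have "ord t 2 dvd 2 * n" using ord_dvd_of_two_power_pm1 by blast
  then have "ord t 2 dvd n" using assms(3) by (simp add: coprime_dvd_mult_right_iff)
  then have "[2 ^ n = 1] (mod t)" using ord_divides by blast
  then have "[2 ^ n + 1 = 1 + 1] (mod t)" by (rule cong_add) simp
  then have "t dvd 2" using t cong_dvd_iff by (metis one_add_one)
  then have "t \<le> 2" by (intro dvd_imp_le) simp_all
  then have "t = 2" using assms(2) by simp
  then show False using assms(1) by simp
qed

text \<open>A further factor t in N would make t^(k+1) divide L, against the exact multiplicity k.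
  This is how the primes of a cofactor are seen to satisfy the star condition.\<close>

lemma prime_factor_of_cofactor:
  assumes "L = t ^ k * N" "prime t" "multiplicity t L = k" "odd L" "prime p" "p dvd N"
  shows "p \<in> prime_factors L - {t}"
proof -
  have "L \<noteq> 0" using assms(4) by (intro notI) simp
  have "p \<noteq> t"
  proof
    assume "p = t"
    then have "t ^ Suc k dvd L" using assms(6)
      unfolding assms(1) power_Suc2 by (intro mult_dvd_mono) simp_all
    then show False using assms(3) \<open>L \<noteq> 0\<close> \<open>prime t\<close>
      by (metis Suc_n_not_le_n multiplicity_geI not_prime_unit)
  qed
  then show ?thesis using assms(1,5,6) \<open>L \<noteq> 0\<close> by (auto simp: in_prime_factors_iff)
qed

section \<open>Construction of the code in cases (a), (b) and (c)\<close>

theorem mainTheorem12: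
  fixes L :: nat
  assumes "odd L"
    and "(3 \<notin> prime_factors L \<and>
           (\<exists>t\<in>prime_factors L. \<not> star_cond t \<and> c_subord t = (t - 1) div 2 \<and>
              multiplicity t L = 1 \<and> (\<forall>p\<in>prime_factors L - {t}. star_cond p)))
       \<or> (multiplicity 3 L = 1 \<and>
           (\<exists>t\<in>prime_factors L - {3}. \<not> star_cond t \<and> c_subord t = (t - 1) div 2 \<and>
              e_ord t = (t - 1) div 2 \<and> multiplicity t L = 1 \<and>
              (\<forall>p\<in>prime_factors L - {3, t}. star_cond p)))
       \<or> (multiplicity 3 L = 2 \<and> (\<forall>p\<in>prime_factors L - {3}. star_cond p))"
  shows "\<exists>C. is_CAC L 3 C \<and> equi_difference L 3 C \<and> card (leave L C) = 2 \<and>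
           (3 dvd L \<longrightarrow> leave L C \<noteq> {L div 3, 2 * L div 3})"
proof -
  have L0: "0 < L" using assms(1) by (intro Nat.gr0I notI) simp
  consider
    (a) t where "3 \<notin> prime_factors L" "t \<in> prime_factors L" "\<not> star_cond t"
      "c_subord t = (t - 1) div 2" "multiplicity t L = 1"
      "\<forall>p\<in>prime_factors L - {t}. star_cond p"
  | (b) t where "multiplicity 3 L = 1" "t \<in> prime_factors L - {3}" "\<not> star_cond t"
      "c_subord t = (t - 1) div 2" "e_ord t = (t - 1) div 2" "multiplicity t L = 1"
      "\<forall>p\<in>prime_factors L - {3, t}. star_cond p"
  | (c) "multiplicity 3 L = 2" "\<forall>p\<in>prime_factors L - {3}. star_cond p"
    using assms(2) by blast
  then show ?thesis
  proof cases
    case a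
    have t: "prime t" "t dvd L" "t \<noteq> 3" using a by (auto simp: in_prime_factors_iff)
    then obtain N where N: "L = t * N" by blast
    show ?thesis
    proof (rule code_of_prime_cycle[OF \<open>odd L\<close> N t(1,3) a(3,4)])
      fix x n
      assume *: "\<not> L dvd t * x" "L dvd (2 ^ n - 1) * x \<or> L dvd (2 ^ n + 1) * x"
      show "even n"
      proof (rule star_cycle_even[OF N L0 _ *])
        fix p assume "prime p" "p dvd N"
        then have "p \<in> prime_factors L - {t}"
          using prime_factor_of_cofactor[of L t 1 N p] N t a(5) \<open>odd L\<close> by simp
        then show "star_cond p" using a(6) by blast
      qed
    qed
  next
    case b
    have t: "prime t" "t dvd L" "t \<noteq> 3" using b by (auto simp: in_prime_factors_iff)
    then obtain N where N: "L = t * N" by blast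
    have "odd t" using N \<open>odd L\<close> by auto
    have "t > 1" using t prime_gt_1_nat by blast
    have "(3::nat) dvd L" using b(1) by (metis multiplicity_dvd power_one_right)
    moreover have cop: "coprime 3 t" using t by (intro primes_coprime) auto
    ultimately have "3 dvd N" unfolding N by (simp add: coprime_dvd_mult_right_iff)
    then obtain K where K: "N = 3 * K" by blast
    have LK: "L = (3 * t) * K" using N K by simp
    \<comment> \<open>The order equals the suborder (t - 1) / 2, which is odd because t violates the
      star condition.\<close>
    have odd_e: "odd (ord t 2)"
      using odd_c_subord[OF t(1) \<open>odd t\<close> b(3,4)] b(5) by (simp add: e_ord_def)
    show ?thesis
    proof (rule code_of_prime_cycle[OF \<open>odd L\<close> N t(1,3) b(3,4)])
      fix x n
      assume H: "x \<in> half_range L" "3 * x \<noteq> L"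
        and *: "\<not> L dvd t * x" "L dvd (2 ^ n - 1) * x \<or> L dvd (2 ^ n + 1) * x"
      \<comment> \<open>If the additive order of x does not divide 3t, it shares a star prime with
        K. Otherwise it divides 3t but neither t nor 3, as x is not annihilated by t and is not L/3;
        so it is exactly 3t.\<close>
      show "even n"
      proof (cases "L dvd (3 * t) * x")
        case False
        show ?thesis
        proof (rule star_cycle_even[OF LK L0 _ False *(2)])
          fix p assume p: "prime p" "p dvd K"
          have "p \<in> prime_factors L - {t}"
            using prime_factor_of_cofactor[of L t 1 N p] N K t b(6) \<open>odd L\<close> p by simp
          moreover have "p \<in> prime_factors L - {3}"
            using prime_factor_of_cofactor[of L 3 1 "t * K" p] LK b(1) \<open>odd L\<close> p by simp
          ultimately show "star_cond p" using b(7) by blast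
        qed
      next
        case True
        have K0: "K > 0" using LK L0 by (intro Nat.gr0I notI) simp
        have "(3 * t) * K dvd (3 * t) * x" using True LK by simp
        then have "K dvd x" using \<open>t > 1\<close> by simp
        then obtain j where j: "x = j * K" by (metis dvdE mult.commute)
        have "\<not> 3 dvd j" using *(1) K0 \<open>t > 1\<close> unfolding LK j by (auto simp: algebra_simps)
        \<comment> \<open>Otherwise x = i L/3 with 2i < 3, which is the excluded element
          L/3.\<close>
        have "\<not> t dvd j"
        proof
          assume "t dvd j"
          then obtain i where i: "j = t * i" by blast
          have "0 < t * K * i" "t * K * (2 * i) < t * K * 3"
            using H(1) unfolding half_range_def j i LK by (auto simp: algebra_simps)
          then have "0 < i" "2 * i < 3" using K0 \<open>t > 1\<close> by (auto simp: mult_less_cancel1)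
          then have "i = 1" by simp
          then show False using H(2) unfolding j i LK by simp
        qed
        have cj: "coprime 3 j" "coprime t j"
          using \<open>\<not> 3 dvd j\<close> \<open>\<not> t dvd j\<close> t(1) prime_imp_coprime[of 3 j] prime_imp_coprime[of t j] by auto
        \<comment> \<open>As j is invertible modulo 3t, one and the same sign holds modulo 3 and
          modulo t.\<close>
        have "3 * t dvd k * j" if "L dvd k * x" for k
          using that K0 unfolding LK j by (simp flip: mult.assoc)
        moreover have "3 dvd k \<and> t dvd k" if "3 * t dvd k * j" for k
          using that cj by (meson coprime_dvd_mult_left_iff dvd_mult_left dvd_mult_right)
        ultimately have "3 dvd (2 ^ n - 1 :: nat) \<and> t dvd 2 ^ n - 1 \<or>
            3 dvd (2 ^ n + 1 :: nat) \<and> t dvd 2 ^ n + 1"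
          using *(2) by blast
        then show ?thesis using two_power_pm1_3t_even[OF \<open>odd t\<close> \<open>t > 1\<close> odd_e] by blast
      qed
    qed
  next
    case c
    have "(3::nat) ^ 2 dvd L" using c(1) by (metis multiplicity_dvd)
    then obtain N where N: "L = 9 * N" by auto
    have N0: "N > 0" using N L0 by simp
    \<comment> \<open>The cycle of N = L/9 is N, 2N, 4N, because 8N is reflected to 9N - 8N =
      N.\<close>
    have d1: "dbl L N = 2 * N" and d2: "dbl L (2 * N) = 4 * N" and d3: "dbl L (4 * N) = N"
      using N0 unfolding dbl_def N by auto
    have f1: "(dbl L ^^ 1) N = 2 * N" "(dbl L ^^ 2) N = 4 * N" "(dbl L ^^ 3) N = N"
    proof -
      have "(h ^^ 2) x = h (h x)" "(h ^^ 3) x = h (h (h x))" for h :: "nat \<Rightarrow> nat" and x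
        by (simp_all add: eval_nat_numeral)
      then show "(dbl L ^^ 1) N = 2 * N" "(dbl L ^^ 2) N = 4 * N" "(dbl L ^^ 3) N = N"
        using d1 d2 d3 by simp_all
    qed
    have Q: "(\<lambda>i. (dbl L ^^ i) N) ` {..<3} = {N, 2 * N, 4 * N}"
    proof -
      have "{..<3::nat} = {0, 1, 2}" by auto
      then show ?thesis using f1 by simp
    qed
    show ?thesis
    proof (rule code_of_single_odd_cycle[where ?x0.0 = N and c = 3])
      show "odd L" by fact
      show "N \<in> half_range L" "3 * N \<noteq> L" using N N0 by (auto simp: half_range_def)
      show "odd (3::nat)" by simp
      show "(dbl L ^^ 3) N = N" by (rule f1)
      show "(dbl L ^^ n) N \<noteq> N" if "0 < n" "n < 3" for n
      proof -
        have "n = 1 \<or> n = 2" using that by auto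
        then show ?thesis using f1 N0 by auto
      qed
      fix x n
      assume H: "x \<in> half_range L" "3 * x \<noteq> L" "x \<notin> (\<lambda>i. (dbl L ^^ i) N) ` {..<3}"
        "(dbl L ^^ n) x = x"
      \<comment> \<open>The multiples jN in the half range have j at most 4: j = 3 is L/3, and the
        others form the cycle of N.\<close>
      have "\<not> L dvd 9 * x"
      proof
        assume "L dvd 9 * x"
        then have "N dvd x" unfolding N by simp
        then obtain j where j: "x = j * N" by (metis dvdE mult.commute)
        have "0 < j * N" "(2 * j) * N < 9 * N" using H(1) by (auto simp: half_range_def N j)
        then have "0 < j" "2 * j < 9" by auto
        then have "j = 1 \<or> j = 2 \<or> j = 3 \<or> j = 4" by auto
        moreover have "x \<notin> {N, 2 * N, 4 * N}" using H(3) unfolding Q .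
        ultimately show False using H(2) unfolding N j by auto
      qed
      show "even n"
      proof (rule star_cycle_even[OF N L0 _ \<open>\<not> L dvd 9 * x\<close>])
        show "L dvd (2 ^ n - 1) * x \<or> L dvd (2 ^ n + 1) * x"
          using H(4) dbl_power_fixed_iff[OF \<open>odd L\<close> H(1)] by simp
        fix p assume "prime p" "p dvd N"
        then have "p \<in> prime_factors L - {3}"
          using prime_factor_of_cofactor[of L 3 2 N p] N c(1) \<open>odd L\<close> by simp
        then show "star_cond p" using c(2) by blast
      qed
    qed
  qed
qed

end
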